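(* Let $p\in(0,1/2)$ and let $\Lambda=(\lambda_G)_{G\subseteq K_n}$ be a ($p$-skewed) OCC spectrum with $\lambda_\emptyset=1$, minimal value $\lambda_{\min}$ with $-1<\lambda_{\min}<0$, and spectral gap $\gamma>0$. Set $\nu=\frac{-\lambda_{\min}}{1-\lambda_{\min}}$. Then for every odd-cycle-intersecting family $\mathcal{F}$ of subgraphs of $K_n$: (1) $\mu_p(\mathcal{F})\le\nu$; (2) if $\mu_p(\mathcal{F})=\nu$ then $\widehat{\mathcal{F}}(G)\ne0$ only for $G\in\Lambda_{\min}\cup\{\emptyset\}$; (3) with $w=\sum_{G\notin\Lambda_{\min}\cup\{\emptyset\}}\widehat{\mathcal{F}}(G)^2$, we have $w\le\frac{\nu}{(1-\nu)\gamma}(\nu-\mu_p(\mathcal{F}))$.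
   Context: Subgraphs of $K_n$ are identified with subsets of $X=[n]^{(2)}$. $\mu_p(G)=p^{|G|}(1-p)^{|X|-|G|}$, $\mu_p(\mathcal{F})=\sum_{G\in\mathcal{F}}\mu_p(G)$, and $\langle f,g\rangle=\sum_S\mu_p(S)f(S)g(S)$. For $e\in X$, $\chi_e(S)=\sqrt{p/(1-p)}$ if $e\notin S$ and $-\sqrt{(1-p)/p}$ if $e\in S$; $\chi_R=\prod_{e\in R}\chi_e$; $\widehat{\mathcal{F}}(R)=\langle 1_{\mathcal{F}},\chi_R\rangle$. A family is odd-cycle-intersecting if $G\cap H$ contains an odd cycle for all $G,H$ in it. A linear operator $A$ on real functions on subgraphs of $K_n$ is OCC if (i) whenever $f$ is the indicator of an odd-cycle-intersecting family, $f(G)=1$ implies $Af(G)=0$, and (ii) every $\chi_R$ is an eigenfunction; its OCC spectrum is $(\lambda_G)$ with $A\chi_G=\lambda_G\chi_G$. $\Lambda_{\min}=\{G:\lambda_G=\lambda_{\min}\}$, and the spectral gap is the maximal $\gamma$ with $\lambda_H\ge\lambda_{\min}+\gamma$ for all $H\notin\Lambda_{\min}$. *)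

theory Defs
  imports Complex_Main "HOL-Library.FuncSet" "HOL-Library.Ramsey" "HOL-Library.Indicator_Function"
begin

type_synonym graph = "nat set set"

definition K :: "nat \<Rightarrow> graph" where
  "K n = nsets {1..n} 2"

text \<open>A subgraph of \<open>K n\<close> is its edge set, an element of \<open>Pow (K n)\<close>. Real functions on subgraphs
  are extensional functions on \<open>Pow (K n)\<close>, so that equality of functions means equality on all
  subgraphs of \<open>K n\<close>.\<close>

definition graph_funs :: "nat \<Rightarrow> (graph \<Rightarrow> real) set" where
  "graph_funs n = (Pow (K n) \<rightarrow>\<^sub>E UNIV)"

definition mu_graph :: "nat \<Rightarrow> real \<Rightarrow> graph \<Rightarrow> real" where
  "mu_graph n p G = p ^ card G * (1 - p) ^ (card (K n) - card G)"

definition mu :: "nat \<Rightarrow> real \<Rightarrow> graph set \<Rightarrow> real" where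
  "mu n p F = (\<Sum>G\<in>F. mu_graph n p G)"

definition inner_p :: "nat \<Rightarrow> real \<Rightarrow> (graph \<Rightarrow> real) \<Rightarrow> (graph \<Rightarrow> real) \<Rightarrow> real" where
  "inner_p n p f g = (\<Sum>S\<in>Pow (K n). mu_graph n p S * f S * g S)"

definition chi_edge :: "real \<Rightarrow> nat set \<Rightarrow> graph \<Rightarrow> real" where
  "chi_edge p e S = (if e \<in> S then - sqrt ((1 - p) / p) else sqrt (p / (1 - p)))"

definition chi :: "nat \<Rightarrow> real \<Rightarrow> graph \<Rightarrow> graph \<Rightarrow> real" where
  "chi n p R = (\<lambda>S\<in>Pow (K n). \<Prod>e\<in>R. chi_edge p e S)"

definition family_ind :: "nat \<Rightarrow> graph set \<Rightarrow> graph \<Rightarrow> real" where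
  "family_ind n F = (\<lambda>S\<in>Pow (K n). indicator F S)"

definition fourier :: "nat \<Rightarrow> real \<Rightarrow> graph set \<Rightarrow> graph \<Rightarrow> real" where
  "fourier n p F R = inner_p n p (family_ind n F) (chi n p R)"

text \<open>A cycle is given by the list of its vertices in cyclic order.\<close>

definition contains_odd_cycle :: "graph \<Rightarrow> bool" where
  "contains_odd_cycle G \<longleftrightarrow>
    (\<exists>c. distinct c \<and> 3 \<le> length c \<and> odd (length c) \<and>
      (\<forall>i<length c. {c ! i, c ! (Suc i mod length c)} \<in> G))"

definition odd_cycle_intersecting :: "nat \<Rightarrow> graph set \<Rightarrow> bool" where
  "odd_cycle_intersecting n F \<longleftrightarrow>
    F \<subseteq> Pow (K n) \<and> (\<forall>G\<in>F. \<forall>H\<in>F. contains_odd_cycle (G \<inter> H))"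

definition linear_operator :: "nat \<Rightarrow> ((graph \<Rightarrow> real) \<Rightarrow> graph \<Rightarrow> real) \<Rightarrow> bool" where
  "linear_operator n A \<longleftrightarrow>
    A \<in> graph_funs n \<rightarrow> graph_funs n \<and>
    (\<forall>f\<in>graph_funs n. \<forall>g\<in>graph_funs n.
      A (\<lambda>S\<in>Pow (K n). f S + g S) = (\<lambda>S\<in>Pow (K n). A f S + A g S)) \<and>
    (\<forall>c. \<forall>f\<in>graph_funs n.
      A (\<lambda>S\<in>Pow (K n). c * f S) = (\<lambda>S\<in>Pow (K n). c * A f S))"

definition eigenfunction ::
  "nat \<Rightarrow> ((graph \<Rightarrow> real) \<Rightarrow> graph \<Rightarrow> real) \<Rightarrow> (graph \<Rightarrow> real) \<Rightarrow> real \<Rightarrow> bool" where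
  "eigenfunction n A f c \<longleftrightarrow>
    f \<in> graph_funs n \<and> (\<exists>S\<in>Pow (K n). f S \<noteq> 0) \<and> A f = (\<lambda>S\<in>Pow (K n). c * f S)"

definition OCC :: "nat \<Rightarrow> real \<Rightarrow> ((graph \<Rightarrow> real) \<Rightarrow> graph \<Rightarrow> real) \<Rightarrow> bool" where
  "OCC n p A \<longleftrightarrow>
    linear_operator n A \<and>
    (\<forall>F. odd_cycle_intersecting n F \<longrightarrow>
      (\<forall>G\<in>Pow (K n). family_ind n F G = 1 \<longrightarrow> A (family_ind n F) G = 0)) \<and>
    (\<forall>R\<in>Pow (K n). \<exists>c. eigenfunction n A (chi n p R) c)"

definition OCC_spectrum :: "nat \<Rightarrow> real \<Rightarrow> (graph \<Rightarrow> real) \<Rightarrow> bool" where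
  "OCC_spectrum n p lam \<longleftrightarrow>
    (\<exists>A. OCC n p A \<and> (\<forall>G\<in>Pow (K n). eigenfunction n A (chi n p G) (lam G)))"

definition lam_min :: "nat \<Rightarrow> (graph \<Rightarrow> real) \<Rightarrow> real" where
  "lam_min n lam = Min (lam ` Pow (K n))"

definition Lambda_min :: "nat \<Rightarrow> (graph \<Rightarrow> real) \<Rightarrow> graph set" where
  "Lambda_min n lam = {G \<in> Pow (K n). lam G = lam_min n lam}"

text \<open>The maximum exists as soon as \<open>lam\<close> is not constant on the subgraphs of \<open>K n\<close>.\<close>

definition spectral_gap :: "nat \<Rightarrow> (graph \<Rightarrow> real) \<Rightarrow> real" where
  "spectral_gap n lam =
    (GREATEST \<gamma>. \<forall>H\<in>Pow (K n) - Lambda_min n lam. lam_min n lam + \<gamma> \<le> lam H)"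

end

theory Submission
  imports Defs
begin

text \<open>
  This is Hoffman's bound. Let \<open>f\<close> be the indicator of \<open>F\<close> and \<open>m = \<mu>\<^sub>p(F)\<close>. The OCC property
  gives \<open>\<langle>f, A f\<rangle> = 0\<close>; expanding \<open>f\<close> in the characters turns this into
  \<open>\<Sum> \<lambda>\<^sub>G f\<^sub>G\<^sup>2 = 0\<close>, where \<open>\<Sum> f\<^sub>G\<^sup>2 = m\<close> and \<open>f\<^sub>\<emptyset> = m\<close>. Bounding \<open>\<lambda>\<^sub>G\<close> below by
  \<open>\<lambda>\<^sub>m\<^sub>i\<^sub>n\<close>, and by \<open>\<lambda>\<^sub>m\<^sub>i\<^sub>n + \<gamma>\<close> off \<open>\<Lambda>\<^sub>m\<^sub>i\<^sub>n\<close>, gives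
  \<open>\<gamma> w \<le> m (\<nu> - m) / (1 - \<nu>)\<close>, from which all three claims follow. The only facts needed about
  the characters are the dual orthogonality relation
  \<open>\<Sum>\<^sub>R \<chi>\<^sub>R(S) \<chi>\<^sub>R(T) = [S = T] / \<mu>\<^sub>p(T)\<close>, which factors over the edges, and \<open>\<chi>\<^sub>\<emptyset> = 1\<close>.
\<close>

section \<open>Product measure and Fourier expansion\<close>

lemma finite_K: "finite (K n)"
  by (simp add: K_def finite_imp_finite_nsets)

lemma mu_graph_eq_prod:
  assumes "T \<subseteq> K n"
  shows "mu_graph n p T = (\<Prod>e\<in>K n. if e \<in> T then p else 1 - p)"
proof -
  have fin: "finite T" using assms finite_K finite_subset by blast
  have "(\<Prod>e\<in>K n. if e \<in> T then p else 1 - p) = (\<Prod>e\<in>T. p) * (\<Prod>e\<in>K n - T. 1 - p)"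
    using assms by (simp add: prod.If_cases finite_K Int_absorb1 Diff_eq)
  then show ?thesis
    using assms fin by (simp add: mu_graph_def card_Diff_subset)
qed

text \<open>The two values of \<open>chi_edge\<close> multiply to -1, and this is what makes the
  edge factor \<open>chi_edge p e S * chi_edge p e T + 1\<close> vanish as soon as \<open>S\<close>
  and \<open>T\<close> differ at \<open>e\<close>.\<close>

lemma chi_edge_mult:
  assumes "0 < p" "p < 1"
  shows "chi_edge p e S * chi_edge p e T =
    (if (e \<in> S) \<noteq> (e \<in> T) then - 1 else if e \<in> T then (1 - p) / p else p / (1 - p))"
  using assms by (auto simp: chi_edge_def simp flip: real_sqrt_mult)

lemma sum_chi_mult_chi:
  assumes p: "0 < p" "p < 1" and S: "S \<subseteq> K n" and T: "T \<subseteq> K n"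
  shows "mu_graph n p T * (\<Sum>R\<in>Pow (K n). chi n p R S * chi n p R T) = (if S = T then 1 else 0)"
proof -
  have "(\<Sum>R\<in>Pow (K n). chi n p R S * chi n p R T) =
      (\<Sum>R\<in>Pow (K n). \<Prod>e\<in>R. chi_edge p e S * chi_edge p e T)"
    using S T by (simp add: chi_def prod.distrib)
  also have "\<dots> = (\<Prod>e\<in>K n. chi_edge p e S * chi_edge p e T + 1)"
    by (simp add: prod_add finite_K)
  finally have "mu_graph n p T * (\<Sum>R\<in>Pow (K n). chi n p R S * chi n p R T) =
      (\<Prod>e\<in>K n. (if e \<in> T then p else 1 - p) * (chi_edge p e S * chi_edge p e T + 1))"
    by (simp add: mu_graph_eq_prod[OF T] prod.distrib)
  \<comment> \<open>Where \<open>S\<close> and \<open>T\<close> agree, the weight cancels the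
    factor: p(1 + (1-p)/p) = 1 and (1-p)(1 + p/(1-p)) = 1.\<close>
  also have "\<dots> = (\<Prod>e\<in>K n. if (e \<in> S) = (e \<in> T) then 1 else 0)"
    using p by (intro prod.cong) (auto simp: chi_edge_mult field_simps)
  also have "\<dots> = (if S = T then 1 else 0)"
    using S T by (auto simp: finite_K)
  finally show ?thesis .
qed

lemma fourier_inversion:
  assumes p: "0 < p" "p < 1" and S: "S \<subseteq> K n"
  shows "(\<Sum>R\<in>Pow (K n). inner_p n p f (chi n p R) * chi n p R S) = f S"
proof -
  have "(\<Sum>R\<in>Pow (K n). inner_p n p f (chi n p R) * chi n p R S) =
      (\<Sum>R\<in>Pow (K n). \<Sum>T\<in>Pow (K n). mu_graph n p T * f T * chi n p R T * chi n p R S)"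
    by (simp add: inner_p_def sum_distrib_right)
  also have "\<dots> =
      (\<Sum>T\<in>Pow (K n). \<Sum>R\<in>Pow (K n). mu_graph n p T * f T * chi n p R T * chi n p R S)"
    by (rule sum.swap)
  also have "\<dots> = (\<Sum>T\<in>Pow (K n).
      f T * (mu_graph n p T * (\<Sum>R\<in>Pow (K n). chi n p R S * chi n p R T)))"
    by (simp add: sum_distrib_left mult_ac)
  also have "\<dots> = (\<Sum>T\<in>Pow (K n). if S = T then f T else 0)"
    using p S by (intro sum.cong) (auto simp: sum_chi_mult_chi)
  also have "\<dots> = f S"
    using S by (simp add: finite_K)
  finally show ?thesis .
qed

text \<open>By linearity in the second argument, each character in the expansion of \<open>g\<close>
  is replaced by its inner product with \<open>f\<close>, which supplies the second factor of the
  square. Taking \<open>c\<close> constantly 1 yields Parseval; taking the eigenvalues yields the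
  quadratic form of an operator.\<close>

lemma inner_p_eigen_expansion:
  assumes g: "\<And>S. S \<subseteq> K n \<Longrightarrow>
    g S = (\<Sum>R\<in>Pow (K n). c R * inner_p n p f (chi n p R) * chi n p R S)"
  shows "inner_p n p f g = (\<Sum>R\<in>Pow (K n). c R * (inner_p n p f (chi n p R))\<^sup>2)"
proof -
  have "inner_p n p f g = (\<Sum>S\<in>Pow (K n). \<Sum>R\<in>Pow (K n).
      c R * inner_p n p f (chi n p R) * (mu_graph n p S * f S * chi n p R S))"
    by (simp add: inner_p_def[of n p f g] g sum_distrib_left mult_ac)
  also have "\<dots> = (\<Sum>R\<in>Pow (K n). \<Sum>S\<in>Pow (K n).
      c R * inner_p n p f (chi n p R) * (mu_graph n p S * f S * chi n p R S))"
    by (rule sum.swap)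
  also have "\<dots> = (\<Sum>R\<in>Pow (K n). c R * inner_p n p f (chi n p R) * inner_p n p f (chi n p R))"
    by (simp add: inner_p_def[of n p f "chi n p _"] sum_distrib_left)
  finally show ?thesis by (simp add: power2_eq_square mult.assoc)
qed

lemma parseval:
  assumes "0 < p" "p < 1"
  shows "inner_p n p f f = (\<Sum>R\<in>Pow (K n). (inner_p n p f (chi n p R))\<^sup>2)"
  using inner_p_eigen_expansion[of n f "\<lambda>_. 1" p f] fourier_inversion[OF assms, of _ n f] by simp

section \<open>Operators diagonal in the characters\<close>

lemma linear_operator_sum:
  assumes A: "linear_operator n A" and "finite I" and "\<And>i. i \<in> I \<Longrightarrow> g i \<in> graph_funs n"
  shows "A (\<lambda>S\<in>Pow (K n). \<Sum>i\<in>I. c i * g i S) = (\<lambda>S\<in>Pow (K n). \<Sum>i\<in>I. c i * A (g i) S)"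
  using assms(2,3)
proof (induction I)
  case empty
  have "(\<lambda>S\<in>Pow (K n). 0) \<in> graph_funs n"
    by (simp add: graph_funs_def)
  \<comment> \<open>The zero function is mapped to itself: this is homogeneity with scalar
    0.\<close>
  then have "A (\<lambda>S\<in>Pow (K n). 0 * (\<lambda>S\<in>Pow (K n). 0) S) =
      (\<lambda>S\<in>Pow (K n). 0 * A (\<lambda>S\<in>Pow (K n). 0) S)"
    using A unfolding linear_operator_def by blast
  then show ?case by (simp only: mult_zero_left sum.empty)
next
  case (insert i I)
  let ?h = "\<lambda>S\<in>Pow (K n). c i * g i S" and ?k = "\<lambda>S\<in>Pow (K n). \<Sum>i\<in>I. c i * g i S"
  have "?h \<in> graph_funs n" "?k \<in> graph_funs n"
    by (auto simp: graph_funs_def)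
  then have add: "A (\<lambda>S\<in>Pow (K n). ?h S + ?k S) = (\<lambda>S\<in>Pow (K n). A ?h S + A ?k S)"
    using A unfolding linear_operator_def by blast
  have scale: "A ?h = (\<lambda>S\<in>Pow (K n). c i * A (g i) S)"
    using A insert.prems unfolding linear_operator_def by blast
  have IH: "A ?k = (\<lambda>S\<in>Pow (K n). \<Sum>i\<in>I. c i * A (g i) S)"
    using insert.prems by (intro insert.IH) blast
  have "(\<lambda>S\<in>Pow (K n). \<Sum>i\<in>insert i I. c i * g i S) = (\<lambda>S\<in>Pow (K n). ?h S + ?k S)"
    using insert.hyps by (auto intro!: restrict_ext)
  then have "A (\<lambda>S\<in>Pow (K n). \<Sum>i\<in>insert i I. c i * g i S) = (\<lambda>S\<in>Pow (K n). A ?h S + A ?k S)"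
    using add by simp
  also have "\<dots> = (\<lambda>S\<in>Pow (K n). \<Sum>i\<in>insert i I. c i * A (g i) S)"
    using insert.hyps by (auto simp: scale IH intro!: restrict_ext)
  finally show ?case .
qed

lemma inner_p_diagonal_operator:
  assumes p: "0 < p" "p < 1" and A: "linear_operator n A"
    and eig: "\<And>R. R \<subseteq> K n \<Longrightarrow> eigenfunction n A (chi n p R) (lam R)"
    and f: "f \<in> graph_funs n"
  shows "inner_p n p f (A f) = (\<Sum>R\<in>Pow (K n). lam R * (inner_p n p f (chi n p R))\<^sup>2)"
proof (rule inner_p_eigen_expansion)
  fix S assume S: "S \<subseteq> K n"
  \<comment> \<open>Inversion gives equality on subgraphs of \<open>K n\<close>; extensionality of
    \<open>f\<close> turns it into equality of functions, so that \<open>A\<close> can be applied to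
    both sides.\<close>
  have "f = (\<lambda>S\<in>Pow (K n). \<Sum>R\<in>Pow (K n). inner_p n p f (chi n p R) * chi n p R S)"
    using f fourier_inversion[OF p, of _ n f]
    by (auto simp: graph_funs_def PiE_def extensional_def)
  then have "A f = A (\<lambda>S\<in>Pow (K n). \<Sum>R\<in>Pow (K n). inner_p n p f (chi n p R) * chi n p R S)"
    by (rule arg_cong)
  also have "\<dots> = (\<lambda>S\<in>Pow (K n). \<Sum>R\<in>Pow (K n). inner_p n p f (chi n p R) * A (chi n p R) S)"
    using eig by (intro linear_operator_sum[OF A]) (auto simp: finite_K eigenfunction_def)
  finally have "A f S = (\<Sum>R\<in>Pow (K n). inner_p n p f (chi n p R) * A (chi n p R) S)"
    using S by simp
  also have "\<dots> = (\<Sum>R\<in>Pow (K n). lam R * inner_p n p f (chi n p R) * chi n p R S)"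
    using eig S by (intro sum.cong) (auto simp: eigenfunction_def)
  finally show "A f S = (\<Sum>R\<in>Pow (K n). lam R * inner_p n p f (chi n p R) * chi n p R S)" .
qed

section \<open>Indicators of families and the spectral inequality\<close>

lemma family_ind_graph_funs: "family_ind n F \<in> graph_funs n"
  by (simp add: family_ind_def graph_funs_def)

lemma inner_p_family_ind:
  assumes "F \<subseteq> Pow (K n)"
  shows "inner_p n p (family_ind n F) g = (\<Sum>G\<in>F. mu_graph n p G * g G)"
proof -
  have "inner_p n p (family_ind n F) g =
      (\<Sum>S\<in>Pow (K n). if S \<in> F then mu_graph n p S * g S else 0)"
    unfolding inner_p_def by (intro sum.cong) (auto simp: family_ind_def)
  also have "\<dots> = (\<Sum>G\<in>F. mu_graph n p G * g G)"
    using assms by (simp add: finite_K Int_absorb1 flip: sum.inter_restrict)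
  finally show ?thesis .
qed

lemma inner_p_family_ind_self:
  assumes "F \<subseteq> Pow (K n)"
  shows "inner_p n p (family_ind n F) (family_ind n F) = mu n p F"
  using assms unfolding inner_p_family_ind[OF assms] mu_def
  by (intro sum.cong) (auto simp: family_ind_def)

lemma fourier_empty:
  assumes "F \<subseteq> Pow (K n)"
  shows "fourier n p F {} = mu n p F"
  using assms unfolding fourier_def inner_p_family_ind[OF assms] mu_def
  by (intro sum.cong) (auto simp: chi_def)

lemma lam_min_le: "G \<subseteq> K n \<Longrightarrow> lam_min n lam \<le> lam G"
  by (simp add: lam_min_def finite_K)

text \<open>The element \<open>H\<close> makes the set of non-minimal eigenvalues nonempty. Being
  finite, that set has a minimum, so the \<open>GREATEST\<close> in the definition is
  attained.\<close>

lemma spectral_gap_le: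
  assumes H: "H \<in> Pow (K n) - Lambda_min n lam"
  shows "lam_min n lam + spectral_gap n lam \<le> lam H"
proof -
  let ?D = "Pow (K n) - Lambda_min n lam"
  have fin: "finite (lam ` ?D)" and ne: "lam ` ?D \<noteq> {}"
    using H by (auto simp: finite_K)
  have "spectral_gap n lam = Min (lam ` ?D) - lam_min n lam"
    unfolding spectral_gap_def
  proof (rule Greatest_equality)
    show "\<forall>H\<in>?D. lam_min n lam + (Min (lam ` ?D) - lam_min n lam) \<le> lam H"
      using fin by simp
    fix y assume y: "\<forall>H\<in>?D. lam_min n lam + y \<le> lam H"
    have "lam_min n lam + y \<le> Min (lam ` ?D)"
      using fin ne y by (subst Min_ge_iff) auto
    then show "y \<le> Min (lam ` ?D) - lam_min n lam" by simp
  qed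
  then show ?thesis using fin H by simp
qed

text \<open>The OCC condition makes \<open>A\<close> applied to the indicator of \<open>F\<close>
  vanish on \<open>F\<close>, the only place where the indicator is nonzero. Hence their inner
  product is 0, and the sum is its spectral form.\<close>

lemma sum_spectrum_fourier_eq_0:
  assumes p: "0 < p" "p < 1" and spec: "OCC_spectrum n p lam" and F: "odd_cycle_intersecting n F"
  shows "(\<Sum>G\<in>Pow (K n). lam G * (fourier n p F G)\<^sup>2) = 0"
proof -
  obtain A where A: "OCC n p A"
    and eig: "\<And>G. G \<subseteq> K n \<Longrightarrow> eigenfunction n A (chi n p G) (lam G)"
    using spec unfolding OCC_spectrum_def by blast
  have lin: "linear_operator n A" using A by (simp add: OCC_def)
  have FK: "F \<subseteq> Pow (K n)" using F by (simp add: odd_cycle_intersecting_def)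
  have "A (family_ind n F) G = 0" if "G \<in> F" for G
  proof -
    have "G \<in> Pow (K n)" "family_ind n F G = 1"
      using FK that by (auto simp: family_ind_def)
    then show ?thesis using A F unfolding OCC_def by blast
  qed
  then have "inner_p n p (family_ind n F) (A (family_ind n F)) = 0"
    by (simp add: inner_p_family_ind[OF FK])
  then show ?thesis
    using inner_p_diagonal_operator[OF p lin eig family_ind_graph_funs]
    by (simp add: fourier_def)
qed

lemma hoffman_stability:
  assumes p: "0 < p" "p < 1" and spec: "OCC_spectrum n p lam" and F: "odd_cycle_intersecting n F"
    and one: "lam {} = 1"
  shows "spectral_gap n lam *
      (\<Sum>G\<in>Pow (K n) - (Lambda_min n lam \<union> {{}}). (fourier n p F G)\<^sup>2)
    \<le> - lam_min n lam * mu n p F - (1 - lam_min n lam) * (mu n p F)\<^sup>2"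
proof -
  let ?l = "lam_min n lam" and ?g = "spectral_gap n lam" and ?m = "mu n p F"
  let ?f = "\<lambda>G. (fourier n p F G)\<^sup>2" and ?N = "Pow (K n) - {{}}"
  let ?W = "Pow (K n) - (Lambda_min n lam \<union> {{}})"
  have FK: "F \<subseteq> Pow (K n)" using F by (simp add: odd_cycle_intersecting_def)
  have split: "(\<Sum>G\<in>Pow (K n). h G) = h {} + (\<Sum>G\<in>?N. h G)" for h :: "graph \<Rightarrow> real"
    by (rule sum.remove) (auto simp: finite_K)
  \<comment> \<open>The empty graph is split off because its coefficient is known: it contributes
    \<open>?m\<^sup>2\<close> here, and also in \<open>zero\<close> since its eigenvalue is
    1.\<close>
  have pars: "(\<Sum>G\<in>?N. ?f G) = ?m - ?m\<^sup>2"
    using parseval[OF p, of n "family_ind n F"] split[of ?f]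
    by (simp add: inner_p_family_ind_self[OF FK] fourier_empty[OF FK] flip: fourier_def)
  have zero: "(\<Sum>G\<in>?N. lam G * ?f G) = - ?m\<^sup>2"
    using sum_spectrum_fourier_eq_0[OF p spec F] split[of "\<lambda>G. lam G * ?f G"]
    by (simp add: fourier_empty[OF FK] one)
  have "?g * sum ?f ?W = (\<Sum>G\<in>?W. ?g * ?f G)"
    by (rule sum_distrib_left)
  also have "\<dots> \<le> (\<Sum>G\<in>?W. (lam G - ?l) * ?f G)"
    using spectral_gap_le[of _ n lam] by (intro sum_mono mult_right_mono) (force simp: algebra_simps)+
  \<comment> \<open>The terms added are those of nonempty graphs in \<open>Lambda_min\<close>; no
    term is negative, as \<open>?l\<close> is the least eigenvalue.\<close>
  also have "\<dots> \<le> (\<Sum>G\<in>?N. (lam G - ?l) * ?f G)"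
    using lam_min_le[of _ n lam] by (intro sum_mono2) (auto simp: finite_K)
  also have "\<dots> = - ?m\<^sup>2 - ?l * (?m - ?m\<^sup>2)"
    by (simp add: left_diff_distrib sum_subtractf zero pars flip: sum_distrib_left)
  finally show ?thesis by (simp add: algebra_simps)
qed

theorem theorem4p1:
  fixes n :: nat and p \<gamma> \<nu> :: real and lam :: "graph \<Rightarrow> real" and F :: "graph set"
  assumes "0 < p" and "p < 1 / 2"
    and "OCC_spectrum n p lam"
    and "lam {} = 1"
    and "- 1 < lam_min n lam" and "lam_min n lam < 0"
    and "\<gamma> = spectral_gap n lam" and "\<gamma> > 0"
    and "\<nu> = - lam_min n lam / (1 - lam_min n lam)"
    and "odd_cycle_intersecting n F"
  shows "mu n p F \<le> \<nu> \<and>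
    (mu n p F = \<nu> \<longrightarrow>
      (\<forall>G\<in>Pow (K n). fourier n p F G \<noteq> 0 \<longrightarrow> G \<in> Lambda_min n lam \<union> {{}})) \<and>
    (\<Sum>G\<in>Pow (K n) - (Lambda_min n lam \<union> {{}}). (fourier n p F G)\<^sup>2)
      \<le> \<nu> / ((1 - \<nu>) * \<gamma>) * (\<nu> - mu n p F)"
proof -
  let ?l = "lam_min n lam" and ?m = "mu n p F"
  let ?W = "Pow (K n) - (Lambda_min n lam \<union> {{}})"
  define w where "w = (\<Sum>G\<in>?W. (fourier n p F G)\<^sup>2)"
  have w0: "0 \<le> w" unfolding w_def by (intro sum_nonneg) simp
  have \<nu>0: "0 < \<nu>" using assms(6,9) by (simp add: divide_neg_pos)
  have m0: "0 \<le> ?m"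
    using assms(1,2) unfolding mu_def mu_graph_def by (intro sum_nonneg) simp
  have one_minus_\<nu>: "1 - \<nu> = 1 / (1 - ?l)"
    using assms(6,9) by (simp add: field_simps)
  have l: "1 - ?l = 1 / (1 - \<nu>)" "- ?l = \<nu> / (1 - \<nu>)"
    unfolding one_minus_\<nu> using assms(6,9) by simp_all
  have "0 < 1 - \<nu>"
    unfolding one_minus_\<nu> using assms(6) by simp
  then have \<nu>1: "\<nu> < 1" by simp
  have "\<gamma> * w \<le> - ?l * ?m - (1 - ?l) * ?m\<^sup>2"
    using hoffman_stability[of p n lam F] assms(1-4,7,10) by (simp add: w_def)
  also have "\<dots> = ?m * (\<nu> - ?m) / (1 - \<nu>)"
    unfolding l by (simp add: right_diff_distrib diff_divide_distrib power2_eq_square mult.commute)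
  finally have key: "\<gamma> * w \<le> ?m * (\<nu> - ?m) / (1 - \<nu>)" .
  have "0 \<le> \<gamma> * w" using w0 assms(8) by simp
  then have "0 \<le> ?m * (\<nu> - ?m)"
    using key \<nu>1 by (smt (verit) divide_neg_pos)
  \<comment> \<open>If \<open>?m\<close> is 0, the product carries no information and positivity of
    \<open>\<nu>\<close> gives the claim.\<close>
  then have m_le: "?m \<le> \<nu>"
    using m0 \<nu>0 by (auto simp: zero_le_mult_iff)
  \<comment> \<open>The first bound feeds into the third: it allows the factor \<open>?m\<close> to
    be replaced by \<open>\<nu>\<close>, the other factor \<open>\<nu> - ?m\<close> being
    nonnegative.\<close>
  have "\<gamma> * w \<le> \<nu> * (\<nu> - ?m) / (1 - \<nu>)"
    using key m_le \<nu>1 by (smt (verit) divide_right_mono mult_right_mono)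
  then have w_le: "w \<le> \<nu> / ((1 - \<nu>) * \<gamma>) * (\<nu> - ?m)"
    using assms(8) \<nu>1 by (simp add: field_simps)
  have "fourier n p F G = 0" if "?m = \<nu>" "G \<in> ?W" for G
  proof -
    \<comment> \<open>In the extremal case the stability bound is 0, and a vanishing sum of squares
      has only zero terms.\<close>
    have "w = 0" using w_le w0 that(1) by simp
    then show ?thesis
      using that(2) by (auto simp: w_def sum_nonneg_eq_0_iff finite_K)
  qed
  then show ?thesis
    using m_le w_le unfolding w_def by blast
qed

end
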